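(* The belief revision operator $\mathrm R$ and the expansion operator $\mathrm E$ (both defined in the context) satisfy: (BR1) $\mathrm R(M\vert e)\in\mathbf M_{AD}(V)\cup\{\langle\mathscr U;\mathscr U\rangle\}$ for all $M\in\mathbf M_{AD}(V)$ and all $e\in\mathscr E$; (BR2) $M_e\subseteq\mathrm R(M\vert e)$ for all $M\in\mathbf M_{AD}(V)$ and all $e\in\mathscr E$; (BR3) $\mathrm R(M\vert e)\subseteq\mathrm E(M\vert e)$ for all $M\in\mathbf M_{AD}(V)$ and all $e\in\mathscr E$; (BR5) for all $M\in\mathbf M_{AD}(V)$ and all $e\in\mathscr E$, if $M_e$ is $V$-consistent then $\mathrm R(M\vert e)$ is $V$-consistent; (BR7) $\mathrm R(M\vert e_1\sqcap e_2)\subseteq\mathrm E(\mathrm R(M\vert e_1)\vert e_2)$ for all $M\in\mathbf M_{AD}(V)$ and all $e_1,e_2\in\mathscr E$.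
   Context: Options: $\mathscr U$ is a real linear space with $\mathscr U\neq\{0\}$. For $A,B\subseteq\mathscr U$: $-A=\{-u:u\in A\}$, $A+B=\{u+v:u\in A,v\in B\}$, $A-B=A+(-B)$; $\mathrm{posi}(B)$ is the set of all finite (non-empty) linear combinations of elements of $B$ with strictly positive coefficients; $\mathrm{sh}(B)=\{\lambda u:u\in B,\lambda>0\}$. A convex cone is a set closed under addition and under multiplication by strictly positive reals (the empty set qualifies). Assessments: an assessment is a pair $A=\langle A_{\mathrm{acc}};A_{\mathrm{rej}}\rangle$ of subsets of $\mathscr U$ (accepted and rejected options); inclusion, union and intersection of assessments are componentwise. Its set of desirable options is $A_{\mathrm{des}}=A_{\mathrm{acc}}\cap(-A_{\mathrm{rej}})$. An AD-assessment is an assessment with $A_{\mathrm{rej}}\subseteq-A_{\mathrm{acc}}$ (equivalently $A=\langle A_{\mathrm{acc}};-A_{\mathrm{des}}\rangle$). A statement model is an assessment $M$ with (M1) $0\in M_{\mathrm{acc}}$; (M2) $0\notin M_{\mathrm{rej}}$; (M3) $M_{\mathrm{acc}}$ is a convex cone; (M4) $\mathrm{sh}(M_{\mathrm{rej}})-M_{\mathrm{acc}}\subseteq M_{\mathrm{rej}}$. $\mathbf M$ is the set of all statement models. An AD-model is a statement model that is an AD-assessment. $\mathbf{M}_{AD}(V)$ is the set of AD-models $M$ with $V\subseteq M$. For an assessment $A$, $\mathrm{cl}_{\mathbf M}(A)$ is the intersection of all statement models including $A$, and equals $\langle\mathscr U;\mathscr U\rangle$ if there are none. An assessment $A$ is $V$-consistent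 if $\mathrm{posi}(A_{\mathrm{acc}}\cup V_{\mathrm{acc}})\cap(A_{\mathrm{rej}}\cup V_{\mathrm{rej}})=\emptyset$ (equivalently, some statement model includes $A\cup V$). Background: $V=\langle V_{\mathrm{acc}};-V_{\mathrm{des}}\rangle$ is a fixed AD-model. Write $u\geq v$ iff $u-v\in V_{\mathrm{acc}}$; $u\gtrdot v$ iff $u-v\in V_{\mathrm{des}}$; $u>v$ iff $u\ge v$ and $u\ne v$. Assume there is a unit option $\mathbf 1\in V_{\mathrm{des}}$ such that for every $u\in\mathscr U$ there is a real $\lambda>0$ with $\lambda\mathbf 1\gtrdot u\gtrdot-\lambda\mathbf 1$, and such that $u\gtrdot0$ implies $u\ge\alpha\mathbf 1$ for some real $\alpha>0$. Events: $\mathscr E$ is a non-empty set of events with a calling-off operation $\ast:\mathscr E\times\mathscr U\to\mathscr U$, and kernels $I_e=\{u\in\mathscr U:e\ast u=0\}$, satisfying: (E1) $u\mapsto e\ast u$ is linear; (E2) $e\ast(e\ast u)=e\ast u$; (E3) $u\geq0\Rightarrow e\ast u\geq0$; (E4) there is a unit event $1_{\mathscr E}$ with $1_{\mathscr E}\ast u=u$ for all $u$; (E5) there is a null event $0_{\mathscr E}$ with $0_{\mathscr E}\ast u=0$ for all $u$; (E6) if for all $u$, $e_1\ast u>0\Rightarrow e_2\ast u\neq0$, then $e_1\sqsubseteq e_2$, where $e_1\sqsubseteq e_2$ means $e_1\ast u=e_1\ast(e_2\ast u)=e_2\ast(e_1\ast u)$ for all $u$ (and $\sqsubseteq$ is a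 partial order, i.e. events with the same calling-off operation are identified); (E7) $\mathbf 1\geq e\ast\mathbf 1$; (E8) for all $e_1,e_2$ there is an event $e_1\sqcap e_2$ with $I_{e_1}+I_{e_2}=I_{e_1\sqcap e_2}$. For $W\subseteq\mathscr U$, $W\Vert e:=\{u\in\mathscr U:e\ast u\in W\}$. The occurrence of $e$ is represented by the AD-assessment $M_e:=\langle I_e;\emptyset\rangle$. Expansion: $\mathrm E(M\vert e):=\mathrm{cl}_{\mathbf M}(M\cup M_e)$, which equals $\langle M_{\mathrm{acc}}+I_e;-(M_{\mathrm{des}}+I_e)\rangle$ if $0\notin M_{\mathrm{des}}+I_e$ and $\langle\mathscr U;\mathscr U\rangle$ otherwise, for $M\in\mathbf M_{AD}(V)$; also $\mathrm E(\langle\mathscr U;\mathscr U\rangle\vert e)=\langle\mathscr U;\mathscr U\rangle$. Revision: for $M\in\mathbf M_{AD}(V)$ and $e\in\mathscr E$, $$\mathrm R(M\vert e):=\begin{cases}\langle M_{\mathrm{acc}}\Vert e;-(M_{\mathrm{des}}\Vert e\cup(V_{\mathrm{des}}+M_{\mathrm{acc}}\Vert e))\rangle&\text{if }0\notin M_{\mathrm{acc}}\Vert e+V_{\mathrm{des}}\\ \langle V_{\mathrm{acc}}+I_e;-(V_{\mathrm{des}}+I_e)\rangle&\text{if }0\in M_{\mathrm{acc}}\Vert e+V_{\mathrm{des}}\text{ and }0\notin V_{\mathrm{des}}+I_e\\ \langle\mathscr U;\mathscr U\rangle&\text{if }0\in V_{\mathrm{des}}+I_e.\end{cases}$$ *)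

theory Defs
  imports Complex_Main "HOL-Library.Product_Order" "HOL-Library.Set_Algebras"
begin

text \<open>
  An assessment is a pair of sets of options (accepted, rejected). Its inclusion, union and
  intersection are the componentwise \<open>\<le>\<close>, \<open>sup\<close> and \<open>Inf\<close> on products; the assessment
  accepting and rejecting everything is \<open>top\<close>.
  On sets, \<open>+\<close> is the Minkowski sum, whereas the operators \<open>-\<close> are complement
  and set difference. The pointwise negation of \<open>A\<close> is therefore written \<open>uminus ` A\<close>.
\<close>

type_synonym 'a assessment = "'a set \<times> 'a set"

abbreviation acc :: "'a assessment \<Rightarrow> 'a set" where "acc A \<equiv> fst A"
abbreviation rej :: "'a assessment \<Rightarrow> 'a set" where "rej A \<equiv> snd A"

definition des :: "'a::real_vector assessment \<Rightarrow> 'a set" where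
  "des A = acc A \<inter> uminus ` rej A"

definition posi :: "'a::real_vector set \<Rightarrow> 'a set" where
  "posi B = {\<Sum>v\<in>F. c v *\<^sub>R v | F c. finite F \<and> F \<noteq> {} \<and> F \<subseteq> B \<and> (\<forall>v\<in>F. c v > (0::real))}"

definition sh :: "'a::real_vector set \<Rightarrow> 'a set" where
  "sh B = {c *\<^sub>R u | c u. u \<in> B \<and> c > (0::real)}"

text \<open>The empty set qualifies, and only strictly positive scalars are used.\<close>

definition pos_convex_cone :: "'a::real_vector set \<Rightarrow> bool" where
  "pos_convex_cone K \<longleftrightarrow>
     (\<forall>u\<in>K. \<forall>v\<in>K. u + v \<in> K) \<and> (\<forall>u\<in>K. \<forall>c::real. c > 0 \<longrightarrow> c *\<^sub>R u \<in> K)"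

definition AD_assessment :: "'a::real_vector assessment \<Rightarrow> bool" where
  "AD_assessment A \<longleftrightarrow> rej A \<subseteq> uminus ` acc A"

definition statement_model :: "'a::real_vector assessment \<Rightarrow> bool" where
  "statement_model M \<longleftrightarrow>
     0 \<in> acc M \<and> 0 \<notin> rej M \<and> pos_convex_cone (acc M) \<and>
     sh (rej M) + uminus ` acc M \<subseteq> rej M"

definition AD_model :: "'a::real_vector assessment \<Rightarrow> bool" where
  "AD_model M \<longleftrightarrow> statement_model M \<and> AD_assessment M"

definition AD_models :: "'a::real_vector assessment \<Rightarrow> 'a assessment set" where
  "AD_models V = {M. AD_model M \<and> V \<le> M}"

text \<open>If no statement model includes \<open>A\<close>, this is \<open>Inf {} = top\<close>, as required.\<close>

definition cl :: "'a::real_vector assessment \<Rightarrow> 'a assessment" where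
  "cl A = Inf {M. statement_model M \<and> A \<le> M}"

definition consistent :: "'a::real_vector assessment \<Rightarrow> 'a assessment \<Rightarrow> bool" where
  "consistent V A \<longleftrightarrow> posi (acc A \<union> acc V) \<inter> (rej A \<union> rej V) = {}"

definition geq :: "'a::real_vector assessment \<Rightarrow> 'a \<Rightarrow> 'a \<Rightarrow> bool" where
  "geq V u v \<longleftrightarrow> u - v \<in> acc V"

definition dgt :: "'a::real_vector assessment \<Rightarrow> 'a \<Rightarrow> 'a \<Rightarrow> bool" where
  "dgt V u v \<longleftrightarrow> u - v \<in> des V"

definition gt :: "'a::real_vector assessment \<Rightarrow> 'a \<Rightarrow> 'a \<Rightarrow> bool" where
  "gt V u v \<longleftrightarrow> geq V u v \<and> u \<noteq> v"

text \<open>Events are the elements of a type \<open>'e\<close>; \<open>call e u\<close> is \<open>u\<close> called off unless \<open>e\<close> occurs.\<close>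

definition kernel :: "('e \<Rightarrow> 'a::real_vector \<Rightarrow> 'a) \<Rightarrow> 'e \<Rightarrow> 'a set" where
  "kernel call e = {u. call e u = 0}"

definition precedes :: "('e \<Rightarrow> 'a \<Rightarrow> 'a) \<Rightarrow> 'e \<Rightarrow> 'e \<Rightarrow> bool" where
  "precedes call e1 e2 \<longleftrightarrow>
     (\<forall>u. call e1 u = call e1 (call e2 u) \<and> call e1 u = call e2 (call e1 u))"

definition conditional :: "('e \<Rightarrow> 'a \<Rightarrow> 'a) \<Rightarrow> 'a set \<Rightarrow> 'e \<Rightarrow> 'a set" where
  "conditional call W e = {u. call e u \<in> W}"

definition occurrence :: "('e \<Rightarrow> 'a::real_vector \<Rightarrow> 'a) \<Rightarrow> 'e \<Rightarrow> 'a assessment" where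
  "occurrence call e = (kernel call e, {})"

definition expansion ::
  "('e \<Rightarrow> 'a::real_vector \<Rightarrow> 'a) \<Rightarrow> 'a assessment \<Rightarrow> 'e \<Rightarrow> 'a assessment" where
  "expansion call M e = cl (sup M (occurrence call e))"

text \<open>
  For \<open>V \<le> M\<close> with \<open>0 \<in> acc M\<close>, the condition \<open>0 \<in> des V + kernel call e\<close> of the last case
  implies \<open>0 \<in> conditional call (acc M) e + des V\<close>, so the order of the tests is immaterial.
\<close>

definition revision ::
  "'a assessment \<Rightarrow> ('e \<Rightarrow> 'a::real_vector \<Rightarrow> 'a) \<Rightarrow> 'a assessment \<Rightarrow> 'e \<Rightarrow> 'a assessment" where
  "revision V call M e =
     (if 0 \<notin> conditional call (acc M) e + des V then
        (conditional call (acc M) e,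
         uminus ` (conditional call (des M) e \<union> (des V + conditional call (acc M) e)))
      else if 0 \<notin> des V + kernel call e then
        (acc V + kernel call e, uminus ` (des V + kernel call e))
      else top)"

locale event_framework =
  fixes V :: "'a::real_vector assessment"
    and unit_opt :: 'a
    and call :: "'e \<Rightarrow> 'a \<Rightarrow> 'a"
    and unit_event null_event :: 'e
    and meet :: "'e \<Rightarrow> 'e \<Rightarrow> 'e"
  assumes nontrivial: "(UNIV :: 'a set) \<noteq> {0}"
    and background: "AD_model V"
    and unit_des: "unit_opt \<in> des V"
    and unit_bounds: "\<exists>c>0. dgt V (c *\<^sub>R unit_opt) u \<and> dgt V u (- (c *\<^sub>R unit_opt))"
    and unit_below: "dgt V u 0 \<Longrightarrow> \<exists>\<alpha>>0. geq V u (\<alpha> *\<^sub>R unit_opt)"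
    and events_identified: "(\<And>u. call e1 u = call e2 u) \<Longrightarrow> e1 = e2"
    and E1: "linear (call e)"
    and E2: "call e (call e u) = call e u"
    and E3: "geq V u 0 \<Longrightarrow> geq V (call e u) 0"
    and E4: "call unit_event u = u"
    and E5: "call null_event u = 0"
    and E6: "(\<And>u. gt V (call e1 u) 0 \<Longrightarrow> call e2 u \<noteq> 0) \<Longrightarrow> precedes call e1 e2"
    and E7: "geq V unit_opt (call e unit_opt)"
    and E8: "kernel call e1 + kernel call e2 = kernel call (meet e1 e2)"
begin

lemma precedes_refl: "precedes call e e"
  by (simp add: precedes_def E2)

lemma precedes_trans: "precedes call e1 e2 \<Longrightarrow> precedes call e2 e3 \<Longrightarrow> precedes call e1 e3"
  unfolding precedes_def by metis

lemma precedes_antisym: "precedes call e1 e2 \<Longrightarrow> precedes call e2 e1 \<Longrightarrow> e1 = e2"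
  unfolding precedes_def by (metis events_identified)

text \<open>An event is determined by its kernel, so E8 leaves no choice for \<open>meet\<close>.\<close>

lemma kernel_inject: "kernel call e1 = kernel call e2 \<Longrightarrow> e1 = e2"
  by (intro precedes_antisym E6) (auto simp: kernel_def gt_def)

end

lemma expansion_top: "expansion call top e = top"
proof -
  have "{M. statement_model M \<and> sup top (occurrence call e) \<le> M} = {}"
    by (auto simp: statement_model_def top_unique)
  then show ?thesis
    unfolding expansion_def cl_def by (metis Inf_empty)
qed

end

theory Submission
  imports Defs
begin

text \<open>
  Everything rests on the decomposition \<open>u = e \<ast> u + (u - e \<ast> u)\<close> with \<open>u - e \<ast> u\<close> in the kernel
  of \<open>e\<close>: a model accepting \<open>M\<close> and that kernel already accepts \<open>M\<parallel>e\<close>, which gives BR3.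
  For BR7, \<open>e\<^sub>1 \<sqinter> e\<^sub>2 \<sqsubseteq> e\<^sub>1\<close> lets \<open>e\<^sub>1\<close> fix the called-off option, so the same decomposition applies.
  The remaining danger, that revision by \<open>e\<^sub>1\<close> abandons \<open>M\<close> while revision by \<open>e\<^sub>1 \<sqinter> e\<^sub>2\<close> keeps it,
  is excluded by the unit option: abandoning \<open>M\<close> at \<open>e\<close> means that \<open>M\<close> accepts \<open>- (e \<ast> \<one>)\<close>, and
  \<open>(e\<^sub>1 \<sqinter> e\<^sub>2) \<ast> \<one> \<le> e\<^sub>1 \<ast> \<one>\<close>.
\<close>

section \<open>Statement models and AD-models\<close>

lemma statement_model_zero_acc: "statement_model M \<Longrightarrow> 0 \<in> acc M"
  and statement_model_zero_rej: "statement_model M \<Longrightarrow> 0 \<notin> rej M"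
  and statement_model_acc_add: "statement_model M \<Longrightarrow> u \<in> acc M \<Longrightarrow> v \<in> acc M \<Longrightarrow> u + v \<in> acc M"
  and statement_model_acc_scale:
    "statement_model M \<Longrightarrow> u \<in> acc M \<Longrightarrow> (c::real) > 0 \<Longrightarrow> c *\<^sub>R u \<in> acc M"
  by (auto simp: statement_model_def pos_convex_cone_def)

lemma statement_model_rej_scale_diff:
  assumes "statement_model M" "u \<in> rej M" "v \<in> acc M" "(c::real) > 0"
  shows "c *\<^sub>R u - v \<in> rej M"
proof -
  have "c *\<^sub>R u + - v \<in> sh (rej M) + uminus ` acc M"
    using assms by (intro set_plus_intro) (auto simp: sh_def)
  then show ?thesis
    using assms(1) by (auto simp: statement_model_def)
qed

lemma statement_model_rej_diff:
  "statement_model M \<Longrightarrow> u \<in> rej M \<Longrightarrow> v \<in> acc M \<Longrightarrow> u - v \<in> rej M"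
  using statement_model_rej_scale_diff[of M u v 1] by simp

text \<open>A common element \<open>u\<close> would make \<open>u - u = 0\<close> rejected.\<close>

lemma statement_model_disjoint: "statement_model M \<Longrightarrow> acc M \<inter> rej M = {}"
  using statement_model_rej_diff statement_model_zero_rej by fastforce

lemma AD_model_statement_model: "AD_model M \<Longrightarrow> statement_model M"
  by (simp add: AD_model_def)

lemma AD_model_rej: "AD_model M \<Longrightarrow> rej M = uminus ` des M"
  unfolding AD_model_def AD_assessment_def des_def by force

lemma AD_model_des_iff: "AD_model M \<Longrightarrow> u \<in> des M \<longleftrightarrow> - u \<in> rej M"
  by (auto simp: AD_model_rej)

lemma des_subset_acc: "des M \<subseteq> acc M"
  by (auto simp: des_def)

lemma AD_model_zero_des: "AD_model M \<Longrightarrow> 0 \<notin> des M"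
  using AD_model_des_iff[of M 0] statement_model_zero_rej[of M] by (auto simp: AD_model_def)

lemma AD_model_des_add_acc: "AD_model M \<Longrightarrow> u \<in> des M \<Longrightarrow> v \<in> acc M \<Longrightarrow> u + v \<in> des M"
  using statement_model_rej_diff[of M "- u" v] by (simp add: AD_model_des_iff AD_model_def)

lemma AD_model_des_scale: "AD_model M \<Longrightarrow> u \<in> des M \<Longrightarrow> (c::real) > 0 \<Longrightarrow> c *\<^sub>R u \<in> des M"
  using statement_model_rej_scale_diff[of M "- u" 0 c]
  by (simp add: AD_model_des_iff AD_model_def statement_model_zero_acc)

text \<open>The model axioms in terms of desirability: when the rejected options are the negatives
  of \<open>D\<close>, the closure rule for rejection follows once \<open>D\<close> absorbs
  \<open>K\<close> and is closed under positive scaling. Both nontrivial forms of revision have this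
  shape.\<close>

lemma AD_modelI:
  assumes "0 \<in> K" "0 \<notin> D" "D \<subseteq> K"
    and "\<And>u v. u \<in> K \<Longrightarrow> v \<in> K \<Longrightarrow> u + v \<in> K"
    and "\<And>u c. u \<in> K \<Longrightarrow> (c::real) > 0 \<Longrightarrow> c *\<^sub>R u \<in> K"
    and "\<And>u v. u \<in> D \<Longrightarrow> v \<in> K \<Longrightarrow> u + v \<in> D"
    and "\<And>u c. u \<in> D \<Longrightarrow> (c::real) > 0 \<Longrightarrow> c *\<^sub>R u \<in> D"
  shows "AD_model (K, uminus ` D)"
proof -
  have "sh (uminus ` D) + uminus ` K \<subseteq> uminus ` D"
  proof
    fix x assume "x \<in> sh (uminus ` D) + uminus ` K"
    then obtain c :: real and d k where "c > 0" "d \<in> D" "k \<in> K" "x = - (c *\<^sub>R d + k)"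
      by (auto simp: sh_def set_plus_def)
    then show "x \<in> uminus ` D"
      using assms(6,7) by blast
  qed
  then show ?thesis
    using assms
    by (auto simp: AD_model_def AD_assessment_def statement_model_def pos_convex_cone_def)
qed

section \<open>Positive hulls, consistency and expansion\<close>

lemma posi_subset_cone:
  assumes "pos_convex_cone K" "B \<subseteq> K"
  shows "posi B \<subseteq> K"
proof -
  have "(\<Sum>v\<in>F. c v *\<^sub>R v) \<in> K"
    if "finite F" "F \<noteq> {}" "F \<subseteq> B" "\<forall>v\<in>F. c v > (0::real)" for F c
    using that
    by (induction rule: finite_ne_induct) (use assms in \<open>auto simp: pos_convex_cone_def\<close>)
  then show ?thesis
    by (auto simp: posi_def)
qed

lemma subset_posi: "B \<subseteq> posi B"
proof
  fix u assume "u \<in> B"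
  then have "\<exists>F c. u = (\<Sum>v\<in>F. c v *\<^sub>R v) \<and> finite F \<and> F \<noteq> {} \<and> F \<subseteq> B \<and> (\<forall>v\<in>F. c v > (0::real))"
    by (intro exI[of _ "{u}"] exI[of _ "\<lambda>_. 1"]) auto
  then show "u \<in> posi B"
    by (simp add: posi_def)
qed

text \<open>Positive combinations cannot leave the cone \<open>acc M\<close>, which already contains
  \<open>acc V\<close> and is disjoint from \<open>rej M\<close>.\<close>

lemma statement_model_consistent:
  assumes "statement_model M" "V \<le> M"
  shows "consistent V M"
proof -
  have "posi (acc M \<union> acc V) \<subseteq> acc M"
    using assms by (intro posi_subset_cone) (auto simp: statement_model_def less_eq_prod_def)
  moreover have "rej M \<union> rej V \<subseteq> rej M"
    using assms(2) by (simp add: less_eq_prod_def)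
  ultimately show ?thesis
    using statement_model_disjoint[OF assms(1)] unfolding consistent_def by blast
qed

text \<open>Since \<open>cl\<close> is an infimum, a bound by each statement model above
  \<open>M\<close> that accepts the kernel suffices. This reduces BR3 and BR7 to an arbitrary such
  \<open>N\<close>.\<close>

lemma le_expansionI:
  assumes "\<And>N. statement_model N \<Longrightarrow> M \<le> N \<Longrightarrow> kernel call e \<subseteq> acc N \<Longrightarrow> A \<le> N"
  shows "A \<le> expansion call M e"
  unfolding expansion_def cl_def
  by (rule Inf_greatest) (use assms in \<open>auto simp: occurrence_def less_eq_prod_def\<close>)

section \<open>Kernels and called-off options\<close>

context event_framework
begin

lemmas background_model = AD_model_statement_model[OF background]

lemma kernel_remainder: "u - call e u \<in> kernel call e"
  by (simp add: kernel_def linear_diff[OF E1] E2)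

lemma kernel_zero: "0 \<in> kernel call e"
  and kernel_add: "u \<in> kernel call e \<Longrightarrow> v \<in> kernel call e \<Longrightarrow> u + v \<in> kernel call e"
  and kernel_scale: "u \<in> kernel call e \<Longrightarrow> c *\<^sub>R u \<in> kernel call e"
  by (simp_all add: kernel_def linear_0[OF E1] linear_add[OF E1] linear_scale[OF E1])

lemma call_acc: "u \<in> acc V \<Longrightarrow> call e u \<in> acc V"
  using E3[of u e] by (simp add: geq_def)

lemma background_subset_conditional:
  "V \<le> M \<Longrightarrow> acc V \<subseteq> conditional call (acc M) e"
  using call_acc by (auto simp: conditional_def less_eq_prod_def)

lemma kernel_subset_conditional:
  "0 \<in> W \<Longrightarrow> kernel call e \<subseteq> conditional call W e"
  by (auto simp: conditional_def kernel_def)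

lemma conditional_add:
  assumes "\<And>u v. u \<in> A \<Longrightarrow> v \<in> B \<Longrightarrow> u + v \<in> C"
    and "u \<in> conditional call A e" "v \<in> conditional call B e"
  shows "u + v \<in> conditional call C e"
  using assms by (simp add: conditional_def linear_add[OF E1])

lemma conditional_scale:
  assumes "\<And>u. u \<in> A \<Longrightarrow> c *\<^sub>R u \<in> A" "u \<in> conditional call A e"
  shows "c *\<^sub>R u \<in> conditional call A e"
  using assms by (simp add: conditional_def linear_scale[OF E1])

section \<open>The two nontrivial forms of revision are AD-models\<close>

lemma AD_model_conditional:
  assumes M: "AD_model M" "V \<le> M" and zero: "0 \<notin> conditional call (acc M) e + des V"
  shows "AD_model (conditional call (acc M) e,
    uminus ` (conditional call (des M) e \<union> (des V + conditional call (acc M) e)))"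
proof (rule AD_modelI)
  let ?K = "conditional call (acc M) e" and ?D = "conditional call (des M) e"
  note sm = AD_model_statement_model[OF M(1)]
  have add: "u + v \<in> ?K" if "u \<in> ?K" "v \<in> ?K" for u v
    using conditional_add[of "acc M" "acc M" "acc M"] statement_model_acc_add[OF sm] that by blast
  have scale: "c *\<^sub>R u \<in> ?K" if "u \<in> ?K" "c > 0" for u and c :: real
    using conditional_scale[of "acc M"] statement_model_acc_scale[OF sm] that by blast
  show "0 \<in> ?K"
    using kernel_subset_conditional[OF statement_model_zero_acc[OF sm]] kernel_zero by blast
  \<comment> \<open>The sum is handled by \<open>zero\<close>; \<open>?D\<close> is handled by
    \<open>call e 0 = 0\<close>, as 0 is never desirable.\<close>
  show "0 \<notin> ?D \<union> (des V + ?K)"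
    using zero AD_model_zero_des[OF M(1)]
    by (auto simp: conditional_def linear_0[OF E1] add.commute)
  show "u + v \<in> ?K" if "u \<in> ?K" "v \<in> ?K" for u v
    using add that by blast
  show "c *\<^sub>R u \<in> ?K" if "u \<in> ?K" "c > 0" for u and c :: real
    using scale that by blast
  \<comment> \<open>By E3, calling off a background option leaves it accepted, so the sum with
    \<open>des V\<close> stays inside the cone.\<close>
  have "des V \<subseteq> ?K"
    using background_subset_conditional[OF M(2)] des_subset_acc by blast
  then show "?D \<union> (des V + ?K) \<subseteq> ?K"
    using add des_subset_acc[of M] by (auto simp: set_plus_def conditional_def)
  show "u + v \<in> ?D \<union> (des V + ?K)" if u: "u \<in> ?D \<union> (des V + ?K)" and v: "v \<in> ?K" for u v
    using u
  proof
    assume "u \<in> ?D"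
    then show ?thesis
      using conditional_add[of "des M" "acc M" "des M"] AD_model_des_add_acc[OF M(1)] v by blast
  next
    assume "u \<in> des V + ?K"
    then obtain d k where "d \<in> des V" "k \<in> ?K" "u = d + k"
      by (auto simp: set_plus_def)
    then show ?thesis
      using add[OF \<open>k \<in> ?K\<close> v] by (auto simp: add.assoc)
  qed
  show "c *\<^sub>R u \<in> ?D \<union> (des V + ?K)" if u: "u \<in> ?D \<union> (des V + ?K)" and c: "c > 0"
    for u and c :: real
    using u
  proof
    assume "u \<in> ?D"
    then show ?thesis
      using conditional_scale[of "des M"] AD_model_des_scale[OF M(1)] c by blast
  next
    assume "u \<in> des V + ?K"
    then obtain d k where "d \<in> des V" "k \<in> ?K" "u = d + k"
      by (auto simp: set_plus_def)
    then show ?thesis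
      using scale c AD_model_des_scale[OF background] by (auto simp: scaleR_add_right)
  qed
qed

text \<open>The kernel is a linear subspace, so adding it to \<open>acc V\<close> and
  \<open>des V\<close> preserves their closure properties. Only 0 becoming desirable could go wrong,
  which \<open>zero\<close> excludes.\<close>

lemma AD_model_background_kernel:
  assumes zero: "0 \<notin> des V + kernel call e"
  shows "AD_model (acc V + kernel call e, uminus ` (des V + kernel call e))"
proof (rule AD_modelI)
  let ?I = "kernel call e"
  show "0 \<in> acc V + ?I"
    using set_plus_intro[OF statement_model_zero_acc[OF background_model] kernel_zero] by simp
  show "0 \<notin> des V + ?I" by fact
  show "des V + ?I \<subseteq> acc V + ?I"
    by (intro set_plus_mono2 des_subset_acc order_refl)
  show "u + v \<in> acc V + ?I" if uv: "u \<in> acc V + ?I" "v \<in> acc V + ?I" for u v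
  proof -
    obtain a i b j where "a \<in> acc V" "i \<in> ?I" "u = a + i" "b \<in> acc V" "j \<in> ?I" "v = b + j"
      using uv by (blast elim: set_plus_elim)
    then show ?thesis
      using set_plus_intro[OF statement_model_acc_add[OF background_model, of a b]
          kernel_add[of i e j]]
      by (simp add: algebra_simps)
  qed
  show "u + v \<in> des V + ?I" if uv: "u \<in> des V + ?I" "v \<in> acc V + ?I" for u v
  proof -
    obtain a i b j where "a \<in> des V" "i \<in> ?I" "u = a + i" "b \<in> acc V" "j \<in> ?I" "v = b + j"
      using uv by (blast elim: set_plus_elim)
    then show ?thesis
      using set_plus_intro[OF AD_model_des_add_acc[OF background, of a b] kernel_add[of i e j]]
      by (simp add: algebra_simps)
  qed
  show "c *\<^sub>R u \<in> acc V + ?I" if "u \<in> acc V + ?I" "c > 0" for u and c :: real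
    using that statement_model_acc_scale[OF background_model]
    by (auto elim!: set_plus_elim simp: scaleR_add_right intro!: set_plus_intro kernel_scale)
  show "c *\<^sub>R u \<in> des V + ?I" if "u \<in> des V + ?I" "c > 0" for u and c :: real
    using that AD_model_des_scale[OF background]
    by (auto elim!: set_plus_elim simp: scaleR_add_right intro!: set_plus_intro kernel_scale)
qed

section \<open>Revision: lower bounds, minimality and consistency\<close>

lemma revision_cases [case_names keep abandon inconsistent]:
  obtains
    "0 \<notin> conditional call (acc M) e + des V"
    "revision V call M e = (conditional call (acc M) e,
      uminus ` (conditional call (des M) e \<union> (des V + conditional call (acc M) e)))"
  | "0 \<in> conditional call (acc M) e + des V" "0 \<notin> des V + kernel call e"
    "revision V call M e = (acc V + kernel call e, uminus ` (des V + kernel call e))"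
  | "0 \<in> des V + kernel call e" "revision V call M e = top"
  unfolding revision_def by metis

lemma background_le_revision:
  assumes "AD_model M" "V \<le> M"
  shows "V \<le> revision V call M e"
proof (cases rule: revision_cases[of M e])
  case keep
  have "0 \<in> conditional call (acc M) e"
    using assms AD_model_statement_model statement_model_zero_acc kernel_zero
      kernel_subset_conditional by blast
  then have "des V \<subseteq> des V + conditional call (acc M) e"
    using set_zero_plus2 by (subst add.commute)
  then show ?thesis
    using keep background_subset_conditional[OF assms(2)] AD_model_rej[OF background]
    by (auto simp: less_eq_prod_def)
next
  case abandon
  have "W \<subseteq> W + kernel call e" for W
    using set_zero_plus2[OF kernel_zero] by (simp add: add.commute)
  then show ?thesis
    using abandon AD_model_rej[OF background] by (auto simp: less_eq_prod_def)
qed simp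

lemma AD_model_revision:
  assumes "AD_model M" "V \<le> M" "revision V call M e \<noteq> top"
  shows "AD_model (revision V call M e)"
  by (cases rule: revision_cases[of M e])
    (use assms AD_model_conditional AD_model_background_kernel in simp_all)

text \<open>This gives BR2, because the occurrence of an event rejects nothing.\<close>

lemma kernel_subset_revision:
  assumes "AD_model M"
  shows "kernel call e \<subseteq> acc (revision V call M e)"
proof (cases rule: revision_cases[of M e])
  case keep
  then show ?thesis
    using assms by (simp add: kernel_subset_conditional statement_model_zero_acc AD_model_def)
next
  case abandon
  then show ?thesis
    using set_zero_plus2[OF statement_model_zero_acc[OF background_model]] by simp
qed (simp add: top_prod_def)

lemma background_kernel_le:
  assumes N: "statement_model N" "V \<le> N" "kernel call e \<subseteq> acc N"
  shows "acc V + kernel call e \<subseteq> acc N" "uminus ` (des V + kernel call e) \<subseteq> rej N"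
proof -
  show "acc V + kernel call e \<subseteq> acc N"
    using N statement_model_acc_add[OF N(1)] by (auto simp: set_plus_def less_eq_prod_def subset_iff)
  have "- (d + i) \<in> rej N" if "d \<in> des V" "i \<in> kernel call e" for d i
  proof -
    have "- d \<in> rej N"
      using that N AD_model_des_iff[OF background] by (auto simp: less_eq_prod_def)
    then have "- d - i \<in> rej N"
      using statement_model_rej_diff[OF N(1)] that N(3) by blast
    then show ?thesis by simp
  qed
  then show "uminus ` (des V + kernel call e) \<subseteq> rej N"
    by (auto simp: set_plus_def)
qed

lemma revision_le_model:
  assumes N: "statement_model N" "V \<le> N" "kernel call e \<subseteq> acc N"
    and acc: "0 \<notin> conditional call (acc M) e + des V \<Longrightarrow>
      (\<And>u. call e u \<in> acc M \<Longrightarrow> call e u \<in> acc N)"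
    and rej: "0 \<notin> conditional call (acc M) e + des V \<Longrightarrow>
      (\<And>u. call e u \<in> des M \<Longrightarrow> - call e u \<in> rej N)"
  shows "revision V call M e \<le> N"
proof (cases rule: revision_cases[of M e])
  case keep
  have K: "conditional call (acc M) e \<subseteq> acc N"
  proof
    fix u assume "u \<in> conditional call (acc M) e"
    then have "call e u + (u - call e u) \<in> acc N"
      using N kernel_remainder acc[OF keep(1)]
      by (intro statement_model_acc_add) (auto simp: conditional_def)
    then show "u \<in> acc N" by simp
  qed
  have D: "- u \<in> rej N" if "u \<in> conditional call (des M) e" for u
  proof -
    \<comment> \<open>The kernel part is accepted by \<open>N\<close>, so it may be subtracted from
      the rejected \<open>- call e u\<close>; the result is \<open>- u\<close>.\<close>
    have "- call e u - (u - call e u) \<in> rej N"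
      using that N kernel_remainder rej[OF keep(1)]
      by (intro statement_model_rej_diff) (auto simp: conditional_def)
    then show ?thesis by simp
  qed
  have "- (d + k) \<in> rej N" if "d \<in> des V" "k \<in> conditional call (acc M) e" for d k
  proof -
    have "- d \<in> rej N"
      using that N AD_model_des_iff[OF background] by (auto simp: less_eq_prod_def)
    then have "- d - k \<in> rej N"
      using statement_model_rej_diff[OF N(1)] that K by blast
    then show ?thesis by simp
  qed
  with K D show ?thesis
    unfolding keep by (auto simp: less_eq_prod_def set_plus_def)
next
  case abandon
  then show ?thesis
    using background_kernel_le[OF N] by (simp add: less_eq_prod_def)
next
  case inconsistent
  \<comment> \<open>No statement model can accept the kernel above \<open>V\<close> in this case, so
    the claim is vacuous.\<close>
  then have "0 \<in> rej N"
    using background_kernel_le(2)[OF N] by force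
  then show ?thesis
    using statement_model_zero_rej[OF N(1)] by blast
qed

lemma revision_le_expansion:
  assumes M: "AD_model M" "V \<le> M"
  shows "revision V call M e \<le> expansion call M e"
proof (rule le_expansionI)
  fix N assume N: "statement_model N" "M \<le> N" "kernel call e \<subseteq> acc N"
  then show "revision V call M e \<le> N"
    using M AD_model_des_iff[OF M(1)]
    by (intro revision_le_model) (auto simp: less_eq_prod_def)
qed

lemma revision_consistent:
  assumes M: "AD_model M" "V \<le> M" and con: "consistent V (occurrence call e)"
  shows "consistent V (revision V call M e)"
proof (cases "revision V call M e = top")
  case True
  \<comment> \<open>\<open>top\<close> rejects 0, whereas the first two cases of revision yield
    AD-models; only the last case can produce \<open>top\<close>.\<close>
  have "\<not> AD_model (top :: 'a assessment)"
    by (simp add: AD_model_def statement_model_def)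
  with True have "0 \<in> des V + kernel call e"
    by (cases rule: revision_cases[of M e])
      (metis AD_model_conditional[OF M], metis AD_model_background_kernel)
  then obtain v i where vi: "v \<in> des V" "i \<in> kernel call e" "v + i = 0"
    by (auto simp: set_plus_def)
  \<comment> \<open>As a kernel element, \<open>i\<close> is accepted through the occurrence of
    \<open>e\<close>; as the negative of a desirable option, it is rejected by \<open>V\<close>.
    This contradicts \<open>con\<close>.\<close>
  then have "i = - v"
    by (simp add: eq_neg_iff_add_eq_0 add.commute)
  then have "i \<in> rej V" "i \<in> posi (kernel call e \<union> acc V)"
    using vi AD_model_des_iff[OF background] subset_posi[of "kernel call e \<union> acc V"] by auto
  then show ?thesis
    using con by (auto simp: consistent_def occurrence_def)
next
  case False
  then show ?thesis
    using AD_model_revision[OF M] background_le_revision[OF M] statement_model_consistent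
      AD_model_statement_model by blast
qed

section \<open>Meets of events and the BR7 inclusion\<close>

lemma kernel_subset_meet:
  "kernel call e1 \<subseteq> kernel call (meet e1 e2)"
  unfolding E8[symmetric] using set_zero_plus2[OF kernel_zero] by (simp add: add.commute)

text \<open>The premise of E6 holds because whatever \<open>e1\<close> calls off to 0, the meet
  calls off to 0 as well.\<close>

lemma meet_precedes: "precedes call (meet e1 e2) e1"
  using kernel_subset_meet[of e1 e2] by (intro E6) (auto simp: kernel_def gt_def)

lemma call_meet: "call e1 (call (meet e1 e2) u) = call (meet e1 e2) u"
  using meet_precedes[of e1 e2] by (simp add: precedes_def)

text \<open>Apply \<open>e1\<close> to the inequality E7 for the meet: E3 preserves it, and
  \<open>e1\<close> fixes the option called off by the meet.\<close>

lemma call_meet_unit_le: "call e1 unit_opt - call (meet e1 e2) unit_opt \<in> acc V"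
proof -
  have "call e1 (unit_opt - call (meet e1 e2) unit_opt) \<in> acc V"
    using E7 call_acc by (simp add: geq_def)
  then show ?thesis
    by (simp add: linear_diff[OF E1] call_meet)
qed

text \<open>Every desirable option dominates a positive multiple of the unit, so testing the unit
  alone decides whether \<open>M\<close> is abandoned.\<close>

lemma abandon_iff:
  assumes M: "AD_model M" "V \<le> M"
  shows "0 \<in> conditional call (acc M) e + des V \<longleftrightarrow> - call e unit_opt \<in> acc M"
proof
  note sm = AD_model_statement_model[OF M(1)]
  assume "0 \<in> conditional call (acc M) e + des V"
  then obtain k v where kv: "call e k \<in> acc M" "v \<in> des V" "k + v = 0"
    by (auto simp: set_plus_def conditional_def)
  then have k: "k = - v"
    by (simp add: eq_neg_iff_add_eq_0)
  obtain \<alpha> where \<alpha>: "\<alpha> > 0" "v - \<alpha> *\<^sub>R unit_opt \<in> acc V"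
    using unit_below[of v] kv(2) by (auto simp: dgt_def geq_def)
  have "call e (v - \<alpha> *\<^sub>R unit_opt) \<in> acc M"
    using call_acc[OF \<alpha>(2)] M(2) by (auto simp: less_eq_prod_def)
  \<comment> \<open>Since \<open>call e k = - call e v\<close>, the terms in \<open>v\<close> cancel
    and only a negative multiple of the called-off unit remains.\<close>
  then have "call e k + call e (v - \<alpha> *\<^sub>R unit_opt) \<in> acc M"
    using kv(1) statement_model_acc_add[OF sm] by blast
  then have "- (\<alpha> *\<^sub>R call e unit_opt) \<in> acc M"
    by (simp add: k linear_neg[OF E1] linear_diff[OF E1] linear_scale[OF E1])
  then have "(1 / \<alpha>) *\<^sub>R - (\<alpha> *\<^sub>R call e unit_opt) \<in> acc M"
    using \<alpha>(1) by (intro statement_model_acc_scale[OF sm]) auto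
  then show "- call e unit_opt \<in> acc M"
    using \<alpha>(1) by simp
next
  assume "- call e unit_opt \<in> acc M"
  then have "- unit_opt \<in> conditional call (acc M) e"
    by (simp add: conditional_def linear_neg[OF E1])
  then have "- unit_opt + unit_opt \<in> conditional call (acc M) e + des V"
    using unit_des by (rule set_plus_intro)
  then show "0 \<in> conditional call (acc M) e + des V"
    by simp
qed

text \<open>Used in contraposition: if revision by the meet keeps \<open>M\<close>, so does revision
  by \<open>e1\<close>.\<close>

lemma abandon_meet:
  assumes M: "AD_model M" "V \<le> M"
    and "0 \<in> conditional call (acc M) e1 + des V"
  shows "0 \<in> conditional call (acc M) (meet e1 e2) + des V"
proof -
  \<comment> \<open>The sum collapses to \<open>- call (meet e1 e2) unit_opt\<close>, the criterion
    of \<open>abandon_iff\<close> at the meet.\<close>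
  have "- call e1 unit_opt + (call e1 unit_opt - call (meet e1 e2) unit_opt) \<in> acc M"
    using assms abandon_iff[OF M] call_meet_unit_le[of e1 e2]
    by (intro statement_model_acc_add) (auto simp: AD_model_def less_eq_prod_def)
  then show ?thesis
    using abandon_iff[OF M] by simp
qed

lemma revision_meet_le_expansion:
  assumes M: "AD_model M" "V \<le> M"
  shows "revision V call M (meet e1 e2) \<le> expansion call (revision V call M e1) e2"
proof (rule le_expansionI)
  fix N assume N: "statement_model N" "revision V call M e1 \<le> N" "kernel call e2 \<subseteq> acc N"
  \<comment> \<open>\<open>N\<close> accepts both kernels, hence their sum, which E8 identifies as
    the kernel of the meet.\<close>
  have "kernel call e1 \<subseteq> acc N"
    using kernel_subset_revision[OF M(1)] N(2) by (force simp: less_eq_prod_def)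
  then have kernel: "kernel call (meet e1 e2) \<subseteq> acc N"
    using N(1,3) unfolding E8[symmetric]
    by (auto simp: set_plus_def intro!: statement_model_acc_add)
  have VN: "V \<le> N"
    using background_le_revision[OF M] N(2) by (rule order_trans)
  show "revision V call M (meet e1 e2) \<le> N"
  proof (rule revision_le_model[OF N(1) VN kernel])
    assume "0 \<notin> conditional call (acc M) (meet e1 e2) + des V"
    then have "0 \<notin> conditional call (acc M) e1 + des V"
      using abandon_meet[OF M] by blast
    \<comment> \<open>With \<open>M\<close> kept at \<open>e1\<close>, the revision included in
      \<open>N\<close> has its first form.\<close>
    then have sub: "conditional call (acc M) e1 \<subseteq> acc N"
        "uminus ` conditional call (des M) e1 \<subseteq> rej N"
      using N(2) by (auto simp: revision_def less_eq_prod_def)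
    \<comment> \<open>By \<open>call_meet\<close>, calling off by \<open>e1\<close> leaves this
      option unchanged, so the option itself lies in
      \<open>conditional call (acc M) e1\<close>.\<close>
    show "call (meet e1 e2) u \<in> acc N" if "call (meet e1 e2) u \<in> acc M" for u
      using sub(1) that by (auto simp: conditional_def call_meet)
    show "- call (meet e1 e2) u \<in> rej N" if "call (meet e1 e2) u \<in> des M" for u
      using sub(2) that by (auto simp: conditional_def call_meet)
  qed
qed

end

theorem proposition8:
  fixes V :: "'a::real_vector assessment"
    and unit_opt :: 'a
    and call :: "'e \<Rightarrow> 'a \<Rightarrow> 'a"
    and unit_event null_event :: 'e
    and meet :: "'e \<Rightarrow> 'e \<Rightarrow> 'e"
  assumes "event_framework V unit_opt call unit_event null_event meet"
  shows "(\<forall>M\<in>AD_models V. \<forall>e. revision V call M e \<in> AD_models V \<union> {top}) \<and>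
    (\<forall>M\<in>AD_models V. \<forall>e. occurrence call e \<le> revision V call M e) \<and>
    (\<forall>M\<in>AD_models V. \<forall>e. revision V call M e \<le> expansion call M e) \<and>
    (\<forall>M\<in>AD_models V. \<forall>e. consistent V (occurrence call e) \<longrightarrow>
        consistent V (revision V call M e)) \<and>
    (\<forall>M\<in>AD_models V. \<forall>e1 e2. revision V call M (meet e1 e2)
        \<le> expansion call (revision V call M e1) e2)"
proof -
  interpret event_framework V unit_opt call unit_event null_event meet
    by fact
  have "revision V call M e \<in> AD_models V \<union> {top}" if "AD_model M" "V \<le> M" for M e
    using AD_model_revision[OF that] background_le_revision[OF that] by (auto simp: AD_models_def)
  moreover have "occurrence call e \<le> revision V call M e" if "AD_model M" for M e
    using kernel_subset_revision[OF that] by (simp add: occurrence_def less_eq_prod_def)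
  ultimately show ?thesis
    using revision_le_expansion revision_consistent revision_meet_le_expansion
    by (simp add: AD_models_def)
qed

end
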